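(* Let $(w_k),(w'_k),(y_k),(x_k)$ be sequences generated by the IneIREG-Bregman algorithm (described in the context), with parameters $\alpha_k\ge 0$, $\lambda_k>0$, $\eta_k>0$, and let $\delta_k:=\frac{\alpha_k(1+\alpha_k)}{2\mu}\|\nabla\omega(x_k)-\nabla\omega(x_{k-1})\|^2$ for $k\ge 0$. Suppose that: (i) $\eta_k\ge\eta_{k+1}$ for all $k\ge0$; (ii) $\alpha_0\in[0,1]$ and $\alpha_k\eta_k^{-1}\ge\alpha_{k+1}\eta_{k+1}^{-1}$ for all $k\ge0$; (iii) $\lambda_k\in[\underline\lambda,\overline\lambda]$ for all $k\ge0$, where $0<\underline\lambda\le\overline\lambda\le\mu/L_0$ and $L_0:=L_F+\eta_0L_H$; (iv) $s:=\sum_{k=0}^\infty\delta_k\eta_k^{-1}<+\infty$. For $k\ge1$ let $\overline y_k:=\frac1{\Lambda_k}\sum_{j=0}^{k-1}\lambda_jy_j$ with $\Lambda_k:=\sum_{j=0}^{k-1}\lambda_j$. Then for all $k\ge1$: (a) (Feasibility) $$0\le\operatorname{Gap}(\overline y_k,F,X)\le\frac1{k\underline\lambda}\left(\Omega_X^2+\sum_{j=0}^{k-1}\delta_j+\overline\lambda\,C_HD_X\sum_{j=0}^{k-1}\eta_j\right).$$ (b) (Optimality) $$-B_H\operatorname{dist}(\overline y_k,Q)\le\operatorname{Gap}(\overline y_k,H,Q)\le\frac1{k\underline\lambda}\left(\frac{\Omega_X^2}{\eta_k}+\sum_{j=0}^{k-1}\frac{\delta_j}{\eta_j}\right).$$ Moreover,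 if $Q$ is $\sigma$-weakly sharp of order $\mathcal M\ge1$, then for all $k\ge1$, $$-\frac{B_H}{\sigma^{1/\mathcal M}}\left\{\frac1{k\underline\lambda}\left(\Omega_X^2+\sum_{j=0}^{k-1}\delta_j+\overline\lambda\,C_HD_X\sum_{j=0}^{k-1}\eta_j\right)\right\}^{1/\mathcal M}\le\operatorname{Gap}(\overline y_k,H,Q).$$
   Context: $\mathbb R^n$ carries its Euclidean inner product $\langle\cdot,\cdot\rangle$ and norm $\|\cdot\|$. Distance-generating function: $\omega:\mathbb R^n\to\mathbb R\cup\{+\infty\}$ is $\mu$-strongly convex ($\mu>0$) with respect to $\|\cdot\|$ and of Legendre type, i.e. proper, closed, strictly convex and essentially smooth (differentiable on $\operatorname{int}(\operatorname{dom}\omega)\ne\emptyset$, with $\|\nabla\omega(x^k)\|\to+\infty$ whenever $(x^k)\subset\operatorname{int}(\operatorname{dom}\omega)$ converges to a boundary point of $\operatorname{dom}\omega$). $\omega^*$ is its convex conjugate. The Bregman distance is $D_\omega(x,y):=\omega(x)-\omega(y)-\langle\nabla\omega(y),x-y\rangle$ for $x\in\operatorname{dom}\omega$, $y\in\operatorname{int}(\operatorname{dom}\omega)$. Problem data: $F:\operatorname{dom}F\subseteq\mathbb R^n\to\mathbb R^n$ and $H:\operatorname{dom}H\subseteq\mathbb R^n\to\mathbb R^n$ are monotone and Lipschitz continuous with constants $L_F>0$ and $L_H>0$. $X$ and $\Omega$ are nonempty closed convex subsets of $\mathbb R^n$ with $X\subset\Omega\subseteq\operatorname{dom}\omega\subseteq\operatorname{dom}F\cap\operatorname{dom}H$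 (inclusions not necessarily strict). $Q:=\{x\in X:\langle F(x),y-x\rangle\ge0\ \ \forall y\in X\}$ is nonempty. Put $C_H:=\sup_{x\in X}\|H(x)\|<+\infty$ and $B_H:=\sup_{x\in Q}\|H(x)\|<+\infty$. Diameters: $D_X:=\sup_{u,v\in X}\|u-v\|$ and $\Omega_X^2:=\sup\{D_\omega(u,v):u\in X,\ v\in X\cap\operatorname{int}(\operatorname{dom}\omega)\}$, both assumed finite. Dual gap functions: $\operatorname{Gap}(z,H,Q):=\sup_{x\in Q}\langle H(x),z-x\rangle$ and $\operatorname{Gap}(z,F,X):=\sup_{x\in X}\langle F(x),z-x\rangle$. Also $\operatorname{dist}(z,Q):=\inf_{q\in Q}\|z-q\|$. $Q$ is $\sigma$-weakly sharp of order $\mathcal M\ge1$ if $\sigma>0$ and $\langle F(x),y-x\rangle\ge\sigma\,(\operatorname{dist}(y,Q))^{\mathcal M}$ for all $x\in Q$, $y\in X$. IneIREG-Bregman algorithm: start with $x_0=x_{-1}\in X\cap\operatorname{int}(\operatorname{dom}\omega)$. For $k=0,1,\dots$, with chosen $\alpha_k\ge0$, $\lambda_k>0$, $\eta_k>0$, set $w_k:=\nabla\omega^*\big((1+\alpha_k)\nabla\omega(x_k)-\alpha_k\nabla\omega(x_{k-1})\big)$, $w'_k:=\operatorname{argmin}_{u\in\Omega}D_\omega(u,w_k)$, $y_k:=\operatorname{argmin}_{u\in X}\{\lambda_k\langle F(w'_k)+\eta_kH(w'_k),u\rangle+D_\omega(u,w_k)\}$, $x_{k+1}:=\operatorname{argmin}_{u\in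 X}\{\lambda_k\langle F(y_k)+\eta_kH(y_k),u\rangle+D_\omega(u,w_k)\}$. (These are well defined, all points lying in $\operatorname{int}(\operatorname{dom}\omega)$.) *)

theory Defs
  imports "HOL-Analysis.Analysis"
begin

section \<open>Extended-valued convex functions\<close>

definition eff_dom :: "('a \<Rightarrow> ereal) \<Rightarrow> 'a set" where
  "eff_dom f = {x. f x < \<infinity>}"

definition proper_fun :: "('a \<Rightarrow> ereal) \<Rightarrow> bool" where
  "proper_fun f \<longleftrightarrow> (\<forall>x. f x \<noteq> -\<infinity>) \<and> eff_dom f \<noteq> {}"

definition closed_fun :: "('a::topological_space \<Rightarrow> ereal) \<Rightarrow> bool" where
  "closed_fun f \<longleftrightarrow> closed {(x, r::real). f x \<le> ereal r}"

definition strictly_convex_fun :: "('a::real_vector \<Rightarrow> ereal) \<Rightarrow> bool" where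
  "strictly_convex_fun f \<longleftrightarrow>
     (\<forall>x\<in>eff_dom f. \<forall>y\<in>eff_dom f. \<forall>t. x \<noteq> y \<and> 0 < t \<and> t < 1 \<longrightarrow>
        f ((1 - t) *\<^sub>R x + t *\<^sub>R y) < ereal (1 - t) * f x + ereal t * f y)"

text \<open>In the next definition \<open>t\<close> is restricted to the open unit interval so that no product
  \<open>0 * \<infinity>\<close> arises; at the two endpoints the inequality is trivial.\<close>

definition strongly_convex_fun :: "real \<Rightarrow> ('a::real_normed_vector \<Rightarrow> ereal) \<Rightarrow> bool" where
  "strongly_convex_fun \<mu> f \<longleftrightarrow> \<mu> > 0 \<and>
     (\<forall>x y t. 0 < t \<and> t < 1 \<longrightarrow>
        f ((1 - t) *\<^sub>R x + t *\<^sub>R y) + ereal (\<mu> / 2 * t * (1 - t) * (norm (x - y))\<^sup>2)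
          \<le> ereal (1 - t) * f x + ereal t * f y)"

text \<open>The gradient of an extended-valued function is that of its real part. It is only meaningful
  in the interior of the effective domain of a proper function, where it is used below.\<close>

definition grad :: "('a::real_inner \<Rightarrow> ereal) \<Rightarrow> 'a \<Rightarrow> 'a" where
  "grad f x = (THE D. GDERIV (\<lambda>z. real_of_ereal (f z)) x :> D)"

definition essentially_smooth :: "('a::real_inner \<Rightarrow> ereal) \<Rightarrow> bool" where
  "essentially_smooth f \<longleftrightarrow>
     interior (eff_dom f) \<noteq> {} \<and>
     (\<forall>x\<in>interior (eff_dom f). (\<lambda>z. real_of_ereal (f z)) differentiable (at x)) \<and>
     (\<forall>u l. (\<forall>k::nat. u k \<in> interior (eff_dom f)) \<and> u \<longlonglongrightarrow> l \<and> l \<in> frontier (eff_dom f)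
        \<longrightarrow> filterlim (\<lambda>k. norm (grad f (u k))) at_top sequentially)"

definition legendre :: "('a::real_inner \<Rightarrow> ereal) \<Rightarrow> bool" where
  "legendre f \<longleftrightarrow>
     proper_fun f \<and> closed_fun f \<and> strictly_convex_fun f \<and> essentially_smooth f"

definition convex_conjugate :: "('a::real_inner \<Rightarrow> ereal) \<Rightarrow> 'a \<Rightarrow> ereal" where
  "convex_conjugate f p = (SUP x. ereal (p \<bullet> x) - f x)"

text \<open>Used for \<open>x\<close> in the effective domain of \<open>\<omega>\<close> and \<open>y\<close> in its interior, so that all values
  involved are finite.\<close>

definition bregman :: "('a::real_inner \<Rightarrow> ereal) \<Rightarrow> 'a \<Rightarrow> 'a \<Rightarrow> real" where
  "bregman \<omega> x y = real_of_ereal (\<omega> x) - real_of_ereal (\<omega> y) - grad \<omega> y \<bullet> (x - y)"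

definition bregman_values :: "('a::real_inner \<Rightarrow> ereal) \<Rightarrow> 'a set \<Rightarrow> real set" where
  "bregman_values \<omega> X = {bregman \<omega> u v | u v. u \<in> X \<and> v \<in> X \<inter> interior (eff_dom \<omega>)}"

section \<open>Variational inequalities\<close>

definition monotone_operator_on :: "'a::real_inner set \<Rightarrow> ('a \<Rightarrow> 'a) \<Rightarrow> bool" where
  "monotone_operator_on A F \<longleftrightarrow> (\<forall>x\<in>A. \<forall>y\<in>A. (F x - F y) \<bullet> (x - y) \<ge> 0)"

definition VI_solutions :: "('a::real_inner \<Rightarrow> 'a) \<Rightarrow> 'a set \<Rightarrow> 'a set" where
  "VI_solutions F X = {x \<in> X. \<forall>y\<in>X. F x \<bullet> (y - x) \<ge> 0}"

text \<open>A supremum in the reals: the set of values is bounded above whenever \<open>A\<close> is bounded and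
  \<open>G\<close> is Lipschitz continuous on \<open>A\<close>.\<close>

definition dual_gap :: "'a::real_inner \<Rightarrow> ('a \<Rightarrow> 'a) \<Rightarrow> 'a set \<Rightarrow> real" where
  "dual_gap z G A = (SUP x\<in>A. G x \<bullet> (z - x))"

definition weakly_sharp ::
  "real \<Rightarrow> real \<Rightarrow> ('a::real_inner \<Rightarrow> 'a) \<Rightarrow> 'a set \<Rightarrow> 'a set \<Rightarrow> bool" where
  "weakly_sharp \<sigma> M F X Q \<longleftrightarrow> \<sigma> > 0 \<and> M \<ge> 1 \<and>
     (\<forall>x\<in>Q. \<forall>y\<in>X. F x \<bullet> (y - x) \<ge> \<sigma> * infdist y Q powr M)"

section \<open>The algorithm\<close>

text \<open>Truncated subtraction on the natural numbers gives \<open>x (0 - 1) = x 0\<close>, which is exactly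
  the initialisation \<open>x\<^sub>-\<^sub>1 = x\<^sub>0\<close>.\<close>

definition IneIREG_Bregman ::
  "('a::real_inner \<Rightarrow> ereal) \<Rightarrow> ('a \<Rightarrow> 'a) \<Rightarrow> ('a \<Rightarrow> 'a) \<Rightarrow> 'a set \<Rightarrow> 'a set \<Rightarrow>
   (nat \<Rightarrow> real) \<Rightarrow> (nat \<Rightarrow> real) \<Rightarrow> (nat \<Rightarrow> real) \<Rightarrow>
   (nat \<Rightarrow> 'a) \<Rightarrow> (nat \<Rightarrow> 'a) \<Rightarrow> (nat \<Rightarrow> 'a) \<Rightarrow> (nat \<Rightarrow> 'a) \<Rightarrow> bool" where
  "IneIREG_Bregman \<omega> F H X \<Omega> \<alpha> lam \<eta> w w' y x \<longleftrightarrow>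
     x 0 \<in> X \<inter> interior (eff_dom \<omega>) \<and>
     (\<forall>k. w k = grad (convex_conjugate \<omega>)
                 ((1 + \<alpha> k) *\<^sub>R grad \<omega> (x k) - \<alpha> k *\<^sub>R grad \<omega> (x (k - 1)))) \<and>
     (\<forall>k. is_arg_min (\<lambda>u. bregman \<omega> u (w k)) (\<lambda>u. u \<in> \<Omega>) (w' k)) \<and>
     (\<forall>k. is_arg_min (\<lambda>u. lam k * ((F (w' k) + \<eta> k *\<^sub>R H (w' k)) \<bullet> u) + bregman \<omega> u (w k))
            (\<lambda>u. u \<in> X) (y k)) \<and>
     (\<forall>k. is_arg_min (\<lambda>u. lam k * ((F (y k) + \<eta> k *\<^sub>R H (y k)) \<bullet> u) + bregman \<omega> u (w k))
            (\<lambda>u. u \<in> X) (x (Suc k)))"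

end

theory Submission
  imports Defs
begin

text \<open>
  Write \<open>D\<close> for the Bregman distance of \<open>\<omega>\<close> and \<open>d\<^sub>k = D(u, x\<^sub>k)\<close> for a fixed comparison point
  \<open>u \<in> X\<close>. Everything follows from one energy inequality per iteration, in which
  \<open>\<lambda>\<^sub>k \<langle>F(u) + \<eta>\<^sub>k H(u), y\<^sub>k - u\<rangle>\<close> is bounded by
  \<open>(d\<^sub>k - d\<^sub>k\<^sub>+\<^sub>1) + \<alpha>\<^sub>k (d\<^sub>k - d\<^sub>k\<^sub>-\<^sub>1) + \<delta>\<^sub>k\<close> (lemma \<open>energy_inequality\<close>).

  It has two ingredients. The extragradient half (\<open>extragradient_step\<close>) compares \<open>x\<^sub>k\<^sub>+\<^sub>1\<close> with the
  extrapolated point \<open>w\<^sub>k\<close>: the objectives of the subproblems are strongly convex, so the minimisers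
  \<open>w'\<^sub>k\<close> and \<open>y\<^sub>k\<close> each yield a quadratic gain, and for \<open>\<lambda>\<^sub>k L\<^sub>0 \<le> \<mu>\<close> these gains absorb the error
  made by evaluating the operator at \<open>w'\<^sub>k\<close> instead of \<open>y\<^sub>k\<close>. Monotonicity then moves the operator
  from \<open>y\<^sub>k\<close> to \<open>u\<close>. The inertial half (\<open>inertial_bregman_le\<close>) bounds \<open>D(u, w\<^sub>k)\<close> by the same
  extrapolation of \<open>d\<^sub>k\<close> and \<open>d\<^sub>k\<^sub>-\<^sub>1\<close> that defines \<open>\<nabla>\<omega>(w\<^sub>k)\<close>: since
  \<open>D(u, w) = \<omega>(u) + \<omega>\<^sup>*(p) - \<langle>p, u\<rangle>\<close> for \<open>p = \<nabla>\<omega>(w)\<close>, the discrepancy comes from \<open>\<omega>\<^sup>*\<close> alone,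
  whose gradient is \<open>1/\<mu>\<close>-Lipschitz, and is at most \<open>\<delta>\<^sub>k\<close>.

  Summing over \<open>k\<close>, directly for feasibility and after division by \<open>\<eta>\<^sub>k\<close> for optimality, leaves
  the distance terms to a summation by parts (\<open>inertial_summation_by_parts\<close>), where the
  monotonicity of \<open>1/\<eta>\<^sub>k\<close> and \<open>\<alpha>\<^sub>k/\<eta>\<^sub>k\<close> and \<open>\<alpha>\<^sub>0 \<le> 1\<close> show that inertia costs nothing beyond the
  \<open>\<delta>\<^sub>k\<close>. In the feasibility sum the \<open>H\<close> terms are bounded by \<open>C\<^sub>H\<close> times the diameter; in the
  optimality sum the \<open>F\<close> terms are nonnegative because \<open>u\<close> solves the variational inequality.

  All of this uses gradients of \<open>\<omega>\<close> at \<open>x\<^sub>k\<close> and \<open>w\<^sub>k\<close>, so these points must be shown to lie in the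
  interior of the domain. That is where essential smoothness enters, through
  \<open>interior_if_slope_bounded_below\<close>; strong convexity and closedness make \<open>\<nabla>\<omega>\<close> surjective with
  inverse \<open>\<nabla>\<omega>\<^sup>*\<close> (\<open>mirror_step\<close>).
\<close>

section \<open>Two elementary estimates and the uniqueness of gradients\<close>

text \<open>In terms of the slacks \<open>e j = M - d j\<close>, nonnegative by hypothesis, both differences telescope up to
  terms of favourable sign, and induction gives the sharper bound \<open>c n * e (n + 1) - b n * e n\<close>.
  The hypothesis \<open>b 0 \<le> c 0\<close> is what starts the induction; the first inertial difference
  vanishes because \<open>0 - 1 = 0\<close>.\<close>

lemma inertial_summation_by_parts:
  fixes d b c :: "nat \<Rightarrow> real"
  assumes d: "\<And>j. 0 \<le> d j" "\<And>j. d j \<le> M"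
    and b: "\<And>j. 0 \<le> b j" "\<And>j. b (Suc j) \<le> b j"
    and c: "\<And>j. c j \<le> c (Suc j)" "b 0 \<le> c 0"
  shows "(\<Sum>j<Suc n. c j * (d j - d (Suc j)) + b j * (d j - d (j - 1))) \<le> c n * M"
proof -
  have "(\<Sum>j<Suc n. c j * (d j - d (Suc j)) + b j * (d j - d (j - 1)))
      \<le> c n * (M - d (Suc n)) - b n * (M - d n)"
  proof (induction n)
    case 0
    have "(c 0 - b 0) * (M - d 0) \<ge> 0"
      using c(2) d(2)[of 0] by simp
    then show ?case
      by (simp add: algebra_simps)
  next
    case (Suc n)
    have "(c (Suc n) - c n) * (M - d (Suc n)) \<ge> 0" "(b n - b (Suc n)) * (M - d n) \<ge> 0"
      using b c d by simp_all
    with Suc show ?case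
      by (simp add: algebra_simps)
  qed
  moreover have "b n * (M - d n) \<ge> 0"
    using b d by simp
  moreover have "0 \<le> c 0"
    using b(1)[of 0] c(2) by linarith
  then have "0 \<le> c n"
    using lift_Suc_mono_le[of c 0 n] c(1) by (metis le0 order_trans)
  then have "0 \<le> c n * d (Suc n)"
    using d by simp
  ultimately show ?thesis
    by (simp add: algebra_simps)
qed

text \<open>Young's inequality, from \<open>0 \<le> (norm (a - m *\<^sub>R b))\<^sup>2\<close>.\<close>

lemma inner_le_half_squares:
  fixes a b :: "'a::real_inner"
  assumes "m > 0"
  shows "a \<bullet> b \<le> (norm a)\<^sup>2 / (2 * m) + m / 2 * (norm b)\<^sup>2"
proof -
  have "0 \<le> (norm (a - m *\<^sub>R b))\<^sup>2 / (2 * m)"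
    using assms by simp
  also have "(norm (a - m *\<^sub>R b))\<^sup>2 = (norm a)\<^sup>2 - 2 * m * (a \<bullet> b) + m\<^sup>2 * (norm b)\<^sup>2"
    unfolding power2_norm_eq_inner
    by (simp add: inner_diff inner_commute algebra_simps power2_eq_square)
  also have "\<dots> / (2 * m) = (norm a)\<^sup>2 / (2 * m) - a \<bullet> b + m / 2 * (norm b)\<^sup>2"
    using assms by (simp add: field_simps power2_eq_square)
  finally show ?thesis by linarith
qed

lemma grad_eqI:
  assumes "GDERIV (\<lambda>z. real_of_ereal (f z)) x :> d"
  shows "grad f x = d"
  unfolding grad_def
proof (rule the_equality)
  fix D assume "GDERIV (\<lambda>z. real_of_ereal (f z)) x :> D"
  with assms have "(\<lambda>h. h \<bullet> D) = (\<lambda>h. h \<bullet> d)"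
    unfolding gderiv_def by (rule has_derivative_unique[rotated])
  then have "(D - d) \<bullet> D = (D - d) \<bullet> d"
    by meson
  then have "(D - d) \<bullet> (D - d) = 0"
    by (simp add: inner_diff_right)
  then show "D = d" by simp
qed (fact assms)

section \<open>Strongly convex functions of Legendre type\<close>

locale legendre_strongly_convex =
  fixes \<omega> :: "'a::euclidean_space \<Rightarrow> ereal" and \<mu> :: real
  assumes strongly_convex: "strongly_convex_fun \<mu> \<omega>"
    and legendre: "legendre \<omega>"
begin

abbreviation dom where "dom \<equiv> eff_dom \<omega>"
abbreviation g where "g z \<equiv> real_of_ereal (\<omega> z)"
abbreviation D where "D \<equiv> bregman \<omega>"

lemma mu_pos: "\<mu> > 0"
  using strongly_convex by (simp add: strongly_convex_fun_def)

lemma finite_on_dom: "z \<in> dom \<Longrightarrow> \<omega> z = ereal (g z)"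
  using legendre unfolding legendre_def proper_fun_def eff_dom_def
  by (cases "\<omega> z") auto

text \<open>A terminating rewrite rule for extended-valued differences: the equation \<open>finite_on_dom\<close> contains
  its own left-hand side on the right.\<close>

lemma ereal_minus_on_dom: "z \<in> dom \<Longrightarrow> ereal a - \<omega> z = ereal (a - g z)"
  using finite_on_dom[of z] by (metis ereal_minus(1))

lemma strong_convexity_on_dom:
  assumes "x \<in> dom" "y \<in> dom" "0 < t" "t < 1"
  shows "(1 - t) *\<^sub>R x + t *\<^sub>R y \<in> dom"
    and "g ((1 - t) *\<^sub>R x + t *\<^sub>R y) + \<mu> / 2 * t * (1 - t) * (norm (x - y))\<^sup>2
      \<le> (1 - t) * g x + t * g y"
proof -
  let ?z = "(1 - t) *\<^sub>R x + t *\<^sub>R y"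
  have le: "\<omega> ?z + ereal (\<mu> / 2 * t * (1 - t) * (norm (x - y))\<^sup>2)
      \<le> ereal ((1 - t) * g x + t * g y)"
    using strongly_convex assms finite_on_dom[OF assms(1)] finite_on_dom[OF assms(2)]
    unfolding strongly_convex_fun_def by (metis plus_ereal.simps(1) times_ereal.simps(1))
  then show z: "?z \<in> dom"
    unfolding eff_dom_def by (cases "\<omega> ?z") auto
  show "g ?z + \<mu> / 2 * t * (1 - t) * (norm (x - y))\<^sup>2 \<le> (1 - t) * g x + t * g y"
    using le finite_on_dom[OF z] by (metis ereal_less_eq(3) plus_ereal.simps(1))
qed

lemma convex_dom: "convex dom"
  unfolding convex_alt
proof (intro ballI allI impI)
  fix x y and u :: real assume "x \<in> dom" "y \<in> dom" "0 \<le> u \<and> u \<le> 1"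
  then show "(1 - u) *\<^sub>R x + u *\<^sub>R y \<in> dom"
    using strong_convexity_on_dom(1)[of x y u] by (cases "u = 0 \<or> u = 1") auto
qed

lemma segment_interior:
  assumes "u \<in> dom" "e \<in> interior dom" "0 < t" "t \<le> 1"
  shows "u + t *\<^sub>R (e - u) \<in> interior dom"
  using mem_interior_convex_shrink[OF convex_dom assms(2,1,3,4)]
  by (simp add: algebra_simps)

text \<open>Essential smoothness provides a Frechet derivative; its Riesz representative, assembled on the
  standard basis, is the gradient.\<close>

lemma GDERIV_grad:
  assumes "x \<in> interior dom"
  shows "GDERIV g x :> grad \<omega> x"
proof -
  from assms obtain f' where f': "(g has_derivative f') (at x)"
    using legendre unfolding legendre_def essentially_smooth_def differentiable_def by blast
  interpret bounded_linear f'
    using f' by (rule has_derivative_bounded_linear)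
  have "f' h = h \<bullet> (\<Sum>i\<in>Basis. f' i *\<^sub>R i)" for h
  proof -
    have "f' h = f' (\<Sum>i\<in>Basis. (h \<bullet> i) *\<^sub>R i)"
      by (simp add: euclidean_representation)
    also have "\<dots> = (\<Sum>i\<in>Basis. (h \<bullet> i) * f' i)"
      by (simp add: sum scaleR)
    finally show ?thesis
      by (simp add: inner_sum_right mult.commute)
  qed
  then have "GDERIV g x :> (\<Sum>i\<in>Basis. f' i *\<^sub>R i)"
    using f' unfolding gderiv_def by (metis (no_types, lifting) ext)
  then show ?thesis
    using grad_eqI by metis
qed

lemma directional_derivative:
  assumes "y \<in> interior dom"
  shows "((\<lambda>t. (g (y + t *\<^sub>R v) - g y) / t) \<longlongrightarrow> grad \<omega> y \<bullet> v) (at_right 0)"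
proof -
  have "((\<lambda>t::real. y + t *\<^sub>R v) has_derivative (\<lambda>t. t *\<^sub>R v)) (at 0)"
    by (auto intro!: derivative_eq_intros)
  moreover have "(g has_derivative (\<lambda>h. h \<bullet> grad \<omega> y)) (at (y + 0 *\<^sub>R v))"
    using GDERIV_grad[OF assms] by (simp add: gderiv_def)
  ultimately have "((\<lambda>t::real. g (y + t *\<^sub>R v)) has_derivative (\<lambda>t. (t *\<^sub>R v) \<bullet> grad \<omega> y)) (at 0)"
    by (rule has_derivative_compose)
  then have "((\<lambda>t::real. g (y + t *\<^sub>R v)) has_real_derivative (grad \<omega> y \<bullet> v)) (at 0)"
    unfolding has_field_derivative_def
    by (rule has_derivative_eq_rhs) (simp add: inner_commute mult.commute fun_eq_iff)
  then show ?thesis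
    unfolding DERIV_def by (simp add: filterlim_at_split)
qed

text \<open>Strong convexity bounds the difference quotients of \<open>\<omega>\<close> along the segment from \<open>y\<close> to \<open>x\<close>;
  the claim is the limit of that bound at \<open>y\<close>.\<close>

lemma bregman_strongly_positive:
  assumes "x \<in> dom" "y \<in> interior dom"
  shows "D x y \<ge> \<mu> / 2 * (norm (x - y))\<^sup>2"
proof -
  have y: "y \<in> dom"
    using assms interior_subset by blast
  have "((\<lambda>t. g x - g y - \<mu> / 2 * (1 - t) * (norm (x - y))\<^sup>2)
      \<longlongrightarrow> g x - g y - \<mu> / 2 * (1 - 0) * (norm (x - y))\<^sup>2) (at_right 0)"
    by (intro tendsto_intros)
  moreover have "\<forall>\<^sub>F t in at_right 0. (g (y + t *\<^sub>R (x - y)) - g y) / t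
      \<le> g x - g y - \<mu> / 2 * (1 - t) * (norm (x - y))\<^sup>2"
    unfolding eventually_at_right_field
  proof (intro exI[of _ 1] conjI allI impI)
    fix t :: real assume t: "0 < t" "t < 1"
    have "y + t *\<^sub>R (x - y) = (1 - t) *\<^sub>R y + t *\<^sub>R x"
      by (simp add: algebra_simps)
    then have "g (y + t *\<^sub>R (x - y)) - g y
        \<le> (g x - g y - \<mu> / 2 * (1 - t) * (norm (x - y))\<^sup>2) * t"
      using strong_convexity_on_dom(2)[OF y assms(1) t]
      by (simp add: left_diff_distrib right_diff_distrib mult_ac norm_minus_commute)
    then show "(g (y + t *\<^sub>R (x - y)) - g y) / t
        \<le> g x - g y - \<mu> / 2 * (1 - t) * (norm (x - y))\<^sup>2"
      using t by (simp add: pos_divide_le_eq)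
  qed simp
  ultimately have "grad \<omega> y \<bullet> (x - y) \<le> g x - g y - \<mu> / 2 * (1 - 0) * (norm (x - y))\<^sup>2"
    using directional_derivative[OF assms(2)] tendsto_le[OF trivial_limit_at_right_real] by blast
  then show ?thesis
    by (simp add: bregman_def)
qed

lemma bregman_nonneg: "x \<in> dom \<Longrightarrow> y \<in> interior dom \<Longrightarrow> D x y \<ge> 0"
  using bregman_strongly_positive[of x y] mu_pos
  by (meson divide_nonneg_pos less_eq_real_def mult_nonneg_nonneg order_trans zero_le_power2 zero_less_numeral)

text \<open>The key to all interiority claims. If \<open>\<omega>\<close> does not decrease infinitely steeply on the way from
  \<open>u\<close> to some interior point \<open>e\<close>, then the gradients at the points
  \<open>u + t *\<^sub>R (e - u)\<close> stay bounded as \<open>t\<close> tends to zero: convexity bounds their component along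
  \<open>e - u\<close> from below by \<open>\<kappa>\<close>, and since \<open>\<omega>\<close> is bounded above on a ball around \<open>e\<close>, the
  subgradient inequality at the points of that ball bounds the full norm. Essential smoothness
  forbids this at a boundary point.\<close>

lemma interior_if_slope_bounded_below:
  assumes u: "u \<in> dom" and e: "e \<in> interior dom"
    and slope: "\<And>t. 0 < t \<Longrightarrow> t < 1 \<Longrightarrow> g (u + t *\<^sub>R (e - u)) \<ge> g u + t * \<kappa>"
  shows "u \<in> interior dom"
proof (rule ccontr)
  assume "u \<notin> interior dom"
  then have fr: "u \<in> frontier dom"
    using u closure_subset by (auto simp: frontier_def)
  have "isCont g e"
    using GDERIV_grad[OF e] has_derivative_continuous unfolding gderiv_def by blast
  then obtain d1 where d1: "d1 > 0" "\<And>z. dist z e < d1 \<Longrightarrow> dist (g z) (g e) < 1"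
    unfolding continuous_at_eps_delta by (meson zero_less_one)
  obtain d2 where d2: "d2 > 0" "ball e d2 \<subseteq> dom"
    using e by (meson mem_interior)
  define r where "r = min d1 d2 / 2"
  have r: "r > 0" "r < d1" "r < d2"
    using d1 d2 by (auto simp: r_def)
  define v where "v n = u + (1 / real (n + 2)) *\<^sub>R (e - u)" for n
  define B where "B = (g e + 1 - g u + 2 * \<bar>\<kappa>\<bar>) / r"
  have "norm (grad \<omega> (v n)) \<le> B" for n
  proof -
    define t where "t = 1 / real (n + 2)"
    have t: "0 < t" "t < 1"
      by (auto simp: t_def)
    have v: "v n = u + t *\<^sub>R (e - u)"
      by (simp add: v_def t_def)
    have vi: "v n \<in> interior dom"
      using segment_interior[OF u e] t v by simp
    let ?p = "grad \<omega> (v n)"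
    \<comment> \<open>The point of the ball around \<open>e\<close> at which the subgradient inequality sees the norm of \<open>?p\<close>.\<close>
    define e' where "e' = e + r *\<^sub>R sgn ?p"
    have "dist e' e \<le> r"
      using r by (simp add: e'_def dist_norm norm_sgn)
    then have "dist e' e < d1" "e' \<in> ball e d2"
      using r by (auto simp: dist_commute)
    then have e': "e' \<in> dom" "g e' < g e + 1"
      using d1(2)[of e'] d2(2) by (auto simp: dist_real_def)
    have "t * (?p \<bullet> (e - u)) \<ge> g (v n) - g u"
      using bregman_nonneg[OF u vi] v by (simp add: bregman_def)
    then have "t * (?p \<bullet> (e - u)) \<ge> t * \<kappa>"
      using slope[OF t] v by simp
    then have "?p \<bullet> (e - u) \<ge> \<kappa>"
      using t by simp
    then have "(1 - t) * (?p \<bullet> (e - u)) \<ge> (1 - t) * \<kappa>"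
      using t by (intro mult_left_mono) auto
    moreover have "\<bar>(1 - t) * \<kappa>\<bar> \<le> \<bar>\<kappa>\<bar>" "\<bar>t * \<kappa>\<bar> \<le> \<bar>\<kappa>\<bar>"
      using t by (simp_all add: abs_mult mult_left_le_one_le)
    moreover have "e - v n = (1 - t) *\<^sub>R (e - u)"
      by (simp add: v algebra_simps)
    then have "?p \<bullet> (e - v n) = (1 - t) * (?p \<bullet> (e - u))"
      by simp
    moreover have "?p \<bullet> (e' - v n) = ?p \<bullet> (e - v n) + r * norm ?p"
    proof -
      have "?p \<bullet> sgn ?p = norm ?p"
        by (cases "?p = 0") (auto simp: sgn_div_norm power2_norm_eq_inner[symmetric] power2_eq_square)
      then show ?thesis
        by (simp add: e'_def inner_add_right inner_diff_right)
    qed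
    moreover have "?p \<bullet> (e' - v n) \<le> g e' - g (v n)"
      using bregman_nonneg[OF e'(1) vi] by (simp add: bregman_def)
    moreover have "g (v n) \<ge> g u + t * \<kappa>"
      using slope[OF t] v by simp
    ultimately have "r * norm ?p \<le> g e + 1 - g u + 2 * \<bar>\<kappa>\<bar>"
      using e'(2) by linarith
    then show ?thesis
      using r by (simp add: B_def field_simps)
  qed
  moreover have "filterlim (\<lambda>n. norm (grad \<omega> (v n))) at_top sequentially"
  proof -
    have "v n \<in> interior dom" for n
      unfolding v_def by (rule segment_interior[OF u e]) auto
    moreover have "(\<lambda>n. 1 / real (n + 2)) \<longlonglongrightarrow> 0"
      by (intro LIMSEQ_ignore_initial_segment lim_1_over_n)
    then have "v \<longlonglongrightarrow> u + 0 *\<^sub>R (e - u)"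
      unfolding v_def by (intro tendsto_intros)
    ultimately show ?thesis
      using fr legendre unfolding legendre_def essentially_smooth_def by auto
  qed
  then have "\<forall>\<^sub>F n in sequentially. norm (grad \<omega> (v n)) > B"
    by (simp add: filterlim_at_top_dense)
  then obtain n where "norm (grad \<omega> (v n)) > B"
    using eventually_happens by force
  ultimately show False
    by (meson not_le)
qed

text \<open>Every subproblem of the algorithm minimises \<open>\<omega>\<close> plus a linear function over a convex subset of
  the domain, so the next facts are stated for this common form. A growth estimate holds at any
  minimiser; the sharper three-point inequality needs a gradient there, hence interiority.\<close>

context
  fixes C :: "'a set" and c u0 :: 'a
  assumes C: "convex C" "C \<subseteq> dom"
    and u0: "u0 \<in> C" "\<And>u. u \<in> C \<Longrightarrow> c \<bullet> u0 + g u0 \<le> c \<bullet> u + g u"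
begin

lemma minimizer_strong:
  assumes u: "u \<in> C"
  shows "c \<bullet> u0 + g u0 + \<mu> / 2 * (norm (u - u0))\<^sup>2 \<le> c \<bullet> u + g u"
proof -
  have "\<mu> / 2 * (norm (u - u0))\<^sup>2 \<le> (c \<bullet> u + g u) - (c \<bullet> u0 + g u0)"
  proof (rule field_le_mult_one_interval)
    fix z :: real assume z: "0 < z" "z < 1"
    define t where "t = 1 - z"
    have t: "0 < t" "t < 1"
      using z by (auto simp: t_def)
    let ?m = "(1 - t) *\<^sub>R u0 + t *\<^sub>R u"
    have "?m \<in> C"
      using C(1) u0(1) u t unfolding convex_alt by auto
    then have "c \<bullet> u0 + g u0 \<le> c \<bullet> ?m + g ?m"
      by (rule u0(2))
    moreover have "g ?m + \<mu> / 2 * t * (1 - t) * (norm (u0 - u))\<^sup>2 \<le> (1 - t) * g u0 + t * g u"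
      using strong_convexity_on_dom(2)[OF _ _ t] u0(1) u C(2) by blast
    ultimately have "t * (z * (\<mu> / 2 * (norm (u - u0))\<^sup>2)) \<le> t * ((c \<bullet> u + g u) - (c \<bullet> u0 + g u0))"
      by (simp add: t_def algebra_simps norm_minus_commute)
    then show "z * (\<mu> / 2 * (norm (u - u0))\<^sup>2) \<le> (c \<bullet> u + g u) - (c \<bullet> u0 + g u0)"
      using t by simp
  qed
  then show ?thesis by simp
qed

text \<open>At a minimiser \<open>\<omega>\<close> can fall along a feasible segment at most as fast as the linear term rises,
  which is the slope condition of \<open>interior_if_slope_bounded_below\<close>.\<close>

lemma minimizer_interior:
  assumes "C \<inter> interior dom \<noteq> {}"
  shows "u0 \<in> interior dom"
proof -
  obtain e where e: "e \<in> C" "e \<in> interior dom"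
    using assms by blast
  show ?thesis
  proof (rule interior_if_slope_bounded_below[OF _ e(2)])
    show "u0 \<in> dom"
      using u0 C by blast
    fix t :: real assume t: "0 < t" "t < 1"
    have "u0 + t *\<^sub>R (e - u0) = (1 - t) *\<^sub>R u0 + t *\<^sub>R e"
      by (simp add: algebra_simps)
    then have "u0 + t *\<^sub>R (e - u0) \<in> C"
      using C(1) u0(1) e(1) t unfolding convex_alt by auto
    then have "c \<bullet> u0 + g u0 \<le> c \<bullet> (u0 + t *\<^sub>R (e - u0)) + g (u0 + t *\<^sub>R (e - u0))"
      by (rule u0(2))
    then show "g (u0 + t *\<^sub>R (e - u0)) \<ge> g u0 + t * - (c \<bullet> (e - u0))"
      by (simp add: inner_add_right)
  qed
qed

lemma minimizer_first_order:
  assumes u: "u \<in> C" and i: "u0 \<in> interior dom"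
  shows "0 \<le> (c + grad \<omega> u0) \<bullet> (u - u0)"
proof -
  have "\<forall>\<^sub>F t in at_right 0. - (c \<bullet> (u - u0)) \<le> (g (u0 + t *\<^sub>R (u - u0)) - g u0) / t"
    unfolding eventually_at_right_field
  proof (intro exI[of _ 1] conjI allI impI)
    fix t :: real assume t: "0 < t" "t < 1"
    have "u0 + t *\<^sub>R (u - u0) = (1 - t) *\<^sub>R u0 + t *\<^sub>R u"
      by (simp add: algebra_simps)
    then have "u0 + t *\<^sub>R (u - u0) \<in> C"
      using C(1) u0(1) u t unfolding convex_alt by auto
    then have "c \<bullet> u0 + g u0 \<le> c \<bullet> (u0 + t *\<^sub>R (u - u0)) + g (u0 + t *\<^sub>R (u - u0))"
      by (rule u0(2))
    then show "- (c \<bullet> (u - u0)) \<le> (g (u0 + t *\<^sub>R (u - u0)) - g u0) / t"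
      using t by (simp add: pos_le_divide_eq inner_add_right mult.commute)
  qed simp
  then have "- (c \<bullet> (u - u0)) \<le> grad \<omega> u0 \<bullet> (u - u0)"
    using tendsto_lowerbound[OF directional_derivative[OF i]] by simp
  then show ?thesis
    by (simp add: inner_add_left)
qed

lemma minimizer_three_point:
  assumes u: "u \<in> C" and i: "u0 \<in> interior dom"
  shows "c \<bullet> u0 + g u0 + D u u0 \<le> c \<bullet> u + g u"
  using minimizer_first_order[OF assms]
  by (simp add: bregman_def inner_add_left inner_diff_right)

end

lemma interior_dom_nonempty: "interior dom \<noteq> {}"
  using legendre by (simp add: legendre_def essentially_smooth_def)

text \<open>The minimisation is carried out over a sublevel set of the epigraph, on which the objective is the
  continuous function \<open>c \<bullet> x + r\<close>. The set is closed because \<open>\<omega>\<close> is, and bounded because the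
  quadratic lower bound around an interior point \<open>e\<close> dominates the linear term.\<close>

lemma ex_minimizer: "\<exists>u0\<in>dom. \<forall>u\<in>dom. c \<bullet> u0 + g u0 \<le> c \<bullet> u + g u"
proof -
  obtain e where e: "e \<in> interior dom"
    using interior_dom_nonempty by blast
  then have ed: "e \<in> dom"
    using interior_subset by blast
  define m where "m = c \<bullet> e + g e"
  define S where "S = {(x, r). \<omega> x \<le> ereal r} \<inter> {z. c \<bullet> fst z + snd z \<le> m}"
  have in_S: "(x, g x) \<in> S" if "x \<in> dom" "c \<bullet> x + g x \<le> m" for x
    using that eq_refl[OF finite_on_dom[OF that(1)]] unfolding S_def by auto
  have S_dom: "fst z \<in> dom" "g (fst z) \<le> snd z" if "z \<in> S" for z
  proof -
    have le: "\<omega> (fst z) \<le> ereal (snd z)"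
      using that by (auto simp: S_def)
    then show d: "fst z \<in> dom"
      unfolding eff_dom_def by auto
    show "g (fst z) \<le> snd z"
      using le finite_on_dom[OF d] by (metis ereal_less_eq(3))
  qed
  \<comment> \<open>Beyond this radius the quadratic lower bound exceeds the linear term.\<close>
  define R where "R = 2 * norm (c + grad \<omega> e) / \<mu>"
  have near: "norm (x - e) \<le> R" if "x \<in> dom" "c \<bullet> x + g x \<le> m" for x
  proof -
    have "\<mu> / 2 * (norm (x - e))\<^sup>2 \<le> g x - g e - grad \<omega> e \<bullet> (x - e)"
      using bregman_strongly_positive[OF that(1) e] by (simp add: bregman_def)
    also have "\<dots> \<le> - ((c + grad \<omega> e) \<bullet> (x - e))"
      using that(2) by (simp add: m_def inner_add_left inner_diff_right)
    also have "\<dots> \<le> norm (c + grad \<omega> e) * norm (x - e)"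
      using norm_cauchy_schwarz[of "- (c + grad \<omega> e)" "x - e"] by (metis inner_minus_left norm_minus_cancel)
    finally have "norm (x - e) * (\<mu> / 2 * norm (x - e)) \<le> norm (x - e) * norm (c + grad \<omega> e)"
      by (simp add: power2_eq_square mult_ac)
    then have "x = e \<or> \<mu> / 2 * norm (x - e) \<le> norm (c + grad \<omega> e)"
      by (metis mult_le_cancel_left_pos right_minus_eq zero_less_norm_iff)
    then show ?thesis
      using mu_pos by (auto simp: R_def field_simps)
  qed
  have "compact S"
  proof -
    have "closed S"
      unfolding S_def using legendre
      by (intro closed_Int closed_Collect_le continuous_intros)
        (simp add: legendre_def closed_fun_def)
    moreover have "S \<subseteq> cball e R \<times> {g e - norm (grad \<omega> e) * R .. m + norm c * (norm e + R)}"
    proof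
      fix z assume z: "z \<in> S"
      obtain x r where zx: "z = (x, r)" by fastforce
      have x: "x \<in> dom" "g x \<le> r" "c \<bullet> x + r \<le> m"
        using S_dom[OF z] z zx by (auto simp: S_def)
      have n: "norm (x - e) \<le> R"
        using near[OF x(1)] x by simp
      have nx: "norm x \<le> norm e + R"
        using n norm_triangle_sub[of x e] by linarith
      have "- (c \<bullet> x) \<le> norm c * norm x"
        using Cauchy_Schwarz_ineq2[of c x] by linarith
      also have "\<dots> \<le> norm c * (norm e + R)"
        using nx by (intro mult_left_mono) auto
      finally have up: "r \<le> m + norm c * (norm e + R)"
        using x(3) by linarith
      have "- (grad \<omega> e \<bullet> (x - e)) \<le> norm (grad \<omega> e) * norm (x - e)"
        using Cauchy_Schwarz_ineq2[of "grad \<omega> e" "x - e"] by linarith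
      also have "\<dots> \<le> norm (grad \<omega> e) * R"
        using n by (intro mult_left_mono) auto
      finally have "g e - norm (grad \<omega> e) * R \<le> r"
        using x(2) bregman_nonneg[OF x(1) e] by (simp add: bregman_def)
      with up n zx show "z \<in> cball e R \<times> {g e - norm (grad \<omega> e) * R .. m + norm c * (norm e + R)}"
        by (simp add: dist_norm norm_minus_commute)
    qed
    then have "bounded S"
      by (rule bounded_subset[rotated]) (simp add: bounded_Times)
    ultimately show ?thesis
      by (simp add: compact_eq_bounded_closed)
  qed
  moreover have eS: "(e, g e) \<in> S"
    using in_S[OF ed] by (simp add: m_def)
  moreover have "continuous_on S (\<lambda>z. c \<bullet> fst z + snd z)"
    by (intro continuous_intros)
  ultimately obtain z where z: "z \<in> S" "\<And>z'. z' \<in> S \<Longrightarrow> c \<bullet> fst z + snd z \<le> c \<bullet> fst z' + snd z'"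
    using continuous_attains_inf[of S "\<lambda>z. c \<bullet> fst z + snd z"] by blast
  show ?thesis
  proof (intro bexI[of _ "fst z"] ballI)
    show "fst z \<in> dom"
      using S_dom z(1) by blast
    fix u assume u: "u \<in> dom"
    show "c \<bullet> fst z + g (fst z) \<le> c \<bullet> u + g u"
    proof (cases "c \<bullet> u + g u \<le> m")
      case True
      then have "(u, g u) \<in> S"
        using in_S[OF u] by simp
      then show ?thesis
        using z(2)[of "(u, g u)"] S_dom(2)[OF z(1)] by simp
    next
      case False
      then show ?thesis
        using S_dom(2)[OF z(1)] z(2)[OF eS] by (simp add: m_def)
    qed
  qed
qed

text \<open>A minimiser \<open>v\<close> of \<open>\<omega>\<close> minus the linear function \<open>p\<close> is an interior point, so its first-order
  condition may be tested in every direction. Testing it with a short step along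
  \<open>p - grad \<omega> v\<close> shows that this residual vanishes.\<close>

lemma grad_surj: "\<exists>v\<in>interior dom. grad \<omega> v = p"
proof -
  obtain v where v: "v \<in> dom" "\<And>u. u \<in> dom \<Longrightarrow> - p \<bullet> v + g v \<le> - p \<bullet> u + g u"
    using ex_minimizer[of "- p"] by blast
  have i: "v \<in> interior dom"
    using minimizer_interior[OF convex_dom order_refl v] interior_dom_nonempty interior_subset
    by blast
  let ?d = "grad \<omega> v - p"
  obtain r where r: "r > 0" "ball v r \<subseteq> dom"
    using i by (meson mem_interior)
  define s where "s = r / (2 * (norm ?d + 1))"
  have s: "s > 0"
    using r by (simp add: s_def add_nonneg_pos)
  have "s * norm ?d \<le> s * (norm ?d + 1)"
    using s by simp
  also have "\<dots> = r / 2"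
    using norm_ge_zero[of ?d] by (simp add: s_def field_simps add_nonneg_eq_0_iff)
  finally have "v - s *\<^sub>R ?d \<in> dom"
    using r s by (intro subsetD[OF r(2)]) (simp add: dist_norm)
  then have "0 \<le> (- p + grad \<omega> v) \<bullet> (v - s *\<^sub>R ?d - v)"
    using minimizer_first_order[OF convex_dom order_refl v _ i] by blast
  then have "s * (?d \<bullet> ?d) \<le> 0"
    by simp
  then have "?d \<bullet> ?d \<le> 0"
    using s by (simp add: mult_le_0_iff)
  then have "?d = 0"
    by (metis inner_eq_zero_iff inner_ge_zero order_antisym)
  with i show ?thesis by auto
qed

text \<open>Around \<open>p = grad \<omega> v\<close> the conjugate is squeezed between the affine function
  \<open>q \<mapsto> q \<bullet> v - \<omega> v\<close>, its value in the supremum at \<open>v\<close>, and the same function plus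
  \<open>(norm (q - p))\<^sup>2 / (2 * \<mu>)\<close>, which is strong convexity of \<open>\<omega>\<close> combined with Young's
  inequality. Two functions touching to second order at \<open>p\<close> force the derivative \<open>v\<close>, and the same
  bounds show that the conjugate is finite.\<close>

lemma grad_conjugate:
  assumes v: "v \<in> interior dom"
  shows "grad (convex_conjugate \<omega>) (grad \<omega> v) = v"
proof -
  let ?p = "grad \<omega> v"
  let ?h = "\<lambda>q. real_of_ereal (convex_conjugate \<omega> q)"
  have vd: "v \<in> dom"
    using v interior_subset by blast
  define l where "l q = q \<bullet> v - g v" for q
  have low: "ereal (l q) \<le> convex_conjugate \<omega> q" for q
    unfolding convex_conjugate_def l_def
    by (rule SUP_upper2[of v]) (simp_all add: ereal_minus_on_dom[OF vd])
  have up: "convex_conjugate \<omega> q \<le> ereal (l q + (norm (q - ?p))\<^sup>2 / (2 * \<mu>))" for q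
    unfolding convex_conjugate_def
  proof (rule SUP_least)
    fix x
    show "ereal (q \<bullet> x) - \<omega> x \<le> ereal (l q + (norm (q - ?p))\<^sup>2 / (2 * \<mu>))"
    proof (cases "x \<in> dom")
      case True
      have "g x \<ge> g v + ?p \<bullet> (x - v) + \<mu> / 2 * (norm (x - v))\<^sup>2"
        using bregman_strongly_positive[OF True v] by (simp add: bregman_def)
      moreover have "(q - ?p) \<bullet> (x - v) \<le> (norm (q - ?p))\<^sup>2 / (2 * \<mu>) + \<mu> / 2 * (norm (x - v))\<^sup>2"
        by (rule inner_le_half_squares[OF mu_pos])
      ultimately have "q \<bullet> x - g x \<le> l q + (norm (q - ?p))\<^sup>2 / (2 * \<mu>)"
        unfolding l_def by (simp add: inner_diff_left inner_diff_right)
      then show ?thesis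
        by (simp add: ereal_minus_on_dom[OF True])
    next
      case False
      then have "\<omega> x = \<infinity>"
        by (simp add: eff_dom_def)
      then show ?thesis by simp
    qed
  qed
  have fin: "convex_conjugate \<omega> q = ereal (?h q)" for q
    using low[of q] up[of q] by (cases "convex_conjugate \<omega> q") auto
  have lowr: "l q \<le> ?h q" and upr: "?h q \<le> l q + (norm (q - ?p))\<^sup>2 / (2 * \<mu>)" for q
    using low[of q] up[of q] fin[of q] by (metis ereal_less_eq(3))+
  have hp: "?h ?p = l ?p"
    using lowr[of ?p] upr[of ?p] by simp
  have "(?h has_derivative (\<lambda>h. h \<bullet> v)) (at ?p)"
  proof (rule has_derivativeI_sandwich[of 1 _ _ _ _ "\<lambda>q. norm (q - ?p) / (2 * \<mu>)"])
    show "bounded_linear (\<lambda>h. h \<bullet> v)"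
      by (rule bounded_linear_inner_left)
    have "((\<lambda>q. norm (q - ?p) / (2 * \<mu>)) \<longlongrightarrow> norm (?p - ?p) / (2 * \<mu>)) (at ?p)"
      using mu_pos by (intro tendsto_intros) auto
    then show "((\<lambda>q. norm (q - ?p) / (2 * \<mu>)) \<longlongrightarrow> 0) (at ?p)"
      by simp
    fix q assume q: "q \<noteq> ?p"
    have "\<bar>?h q - ?h ?p - (q - ?p) \<bullet> v\<bar> \<le> (norm (q - ?p))\<^sup>2 / (2 * \<mu>)"
      using lowr[of q] upr[of q] hp by (simp add: l_def inner_diff_left)
    then show "norm (?h q - ?h ?p - (q - ?p) \<bullet> v) / norm (q - ?p) \<le> norm (q - ?p) / (2 * \<mu>)"
      using q mu_pos by (simp add: divide_le_eq power2_eq_square)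
  qed simp
  then show ?thesis
    by (intro grad_eqI) (simp add: gderiv_def)
qed

lemma mirror_step:
  "grad (convex_conjugate \<omega>) p \<in> interior dom"
  "grad \<omega> (grad (convex_conjugate \<omega>) p) = p"
  using grad_surj[of p] grad_conjugate by auto

section \<open>The two halves of the energy inequality\<close>

text \<open>With \<open>d = grad \<omega> x - grad \<omega> x'\<close> the difference of the two sides before adding the error is
  \<open>a * (d \<bullet> (w - x)) + a * (d \<bullet> (x - x')) - D w x - a * D x' x\<close>. Young's inequality turns the two
  inner products into \<open>a\<^sup>2\<close> and \<open>a\<close> times \<open>(norm d)\<^sup>2 / (2 * \<mu>)\<close>, plus squared distances that
  the two Bregman terms absorb.\<close>

lemma inertial_bregman_le:
  assumes u: "u \<in> dom" and i: "x \<in> interior dom" "x' \<in> interior dom" "w \<in> interior dom"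
    and w: "grad \<omega> w = (1 + a) *\<^sub>R grad \<omega> x - a *\<^sub>R grad \<omega> x'" and a: "a \<ge> 0"
  shows "D u w \<le> D u x + a * (D u x - D u x')
      + a * (1 + a) / (2 * \<mu>) * (norm (grad \<omega> x - grad \<omega> x'))\<^sup>2"
proof -
  define d where "d = grad \<omega> x - grad \<omega> x'"
  have w': "grad \<omega> w = grad \<omega> x + a *\<^sub>R d"
    by (simp add: w d_def algebra_simps)
  have x': "grad \<omega> x' = grad \<omega> x - d"
    by (simp add: d_def)
  have dm: "w \<in> dom" "x' \<in> dom"
    using i interior_subset by blast+
  have 1: "D w x \<ge> \<mu> / 2 * (norm (w - x))\<^sup>2"
    by (rule bregman_strongly_positive[OF dm(1) i(1)])
  have 2: "a * D x' x \<ge> a * (\<mu> / 2 * (norm (x - x'))\<^sup>2)"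
    using bregman_strongly_positive[OF dm(2) i(1)] a
    by (intro mult_left_mono) (auto simp: norm_minus_commute)
  have 3: "(a *\<^sub>R d) \<bullet> (w - x) \<le> (norm (a *\<^sub>R d))\<^sup>2 / (2 * \<mu>) + \<mu> / 2 * (norm (w - x))\<^sup>2"
    by (rule inner_le_half_squares[OF mu_pos])
  have 4: "a * (d \<bullet> (x - x')) \<le> a * ((norm d)\<^sup>2 / (2 * \<mu>) + \<mu> / 2 * (norm (x - x'))\<^sup>2)"
    using inner_le_half_squares[OF mu_pos] a by (rule mult_left_mono)
  have "D u w - D u x - a * (D u x - D u x')
      = (a *\<^sub>R d) \<bullet> (w - x) + a * (d \<bullet> (x - x')) - D w x - a * D x' x"
    unfolding bregman_def w' x' by (simp add: algebra_simps)
  also have "\<dots> \<le> (norm (a *\<^sub>R d))\<^sup>2 / (2 * \<mu>) + a * ((norm d)\<^sup>2 / (2 * \<mu>))"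
    using 1 2 3 4 by (simp add: algebra_simps)
  also have "\<dots> = a * (1 + a) / (2 * \<mu>) * (norm d)\<^sup>2"
    by (simp add: power_mult_distrib add_divide_distrib[symmetric] algebra_simps power2_eq_square)
  finally show ?thesis
    by (simp add: d_def)
qed

text \<open>The terms of \<open>D u w\<close> that do not depend on \<open>u\<close> drop out, which exhibits a Bregman proximal step
  as a problem of the form treated above.\<close>

lemma bregman_prox_minimizer:
  assumes "is_arg_min (\<lambda>u. l * (a \<bullet> u) + D u w) (\<lambda>u. u \<in> C) u0"
  shows "u0 \<in> C"
    and "u \<in> C \<Longrightarrow> (l *\<^sub>R a - grad \<omega> w) \<bullet> u0 + g u0 \<le> (l *\<^sub>R a - grad \<omega> w) \<bullet> u + g u"
  using assms unfolding is_arg_min_linorder bregman_def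
  by (auto simp: inner_diff_left inner_diff_right)

text \<open>The three-point inequality at \<open>xp\<close> reduces the claim to
  \<open>l * (b \<bullet> (y - xp)) \<le> D xp w\<close>. Optimality of \<open>y\<close>, tested at \<open>xp\<close>, replaces \<open>b\<close> by \<open>a\<close> up to the
  error \<open>l * ((b - a) \<bullet> (y - xp))\<close>, and leaves the gains
  \<open>D y w\<close> and \<open>\<mu> / 2 * (norm (xp - y))\<^sup>2\<close>. Optimality of \<open>w'\<close>, tested at \<open>y\<close>, shows that
  \<open>D y w\<close> is at least \<open>\<mu> / 2 * (norm (y - w'))\<^sup>2\<close>; with \<open>l * L \<le> \<mu>\<close>, the two gains together
  dominate the error.\<close>

lemma extragradient_step:
  assumes w: "w \<in> interior dom"
    and sets: "convex X" "convex \<Omega>" "X \<subseteq> \<Omega>" "\<Omega> \<subseteq> dom" "X \<inter> interior dom \<noteq> {}"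
    and w': "is_arg_min (\<lambda>u. D u w) (\<lambda>u. u \<in> \<Omega>) w'"
    and y: "is_arg_min (\<lambda>u. l * (a \<bullet> u) + D u w) (\<lambda>u. u \<in> X) y"
    and xp: "is_arg_min (\<lambda>u. l * (b \<bullet> u) + D u w) (\<lambda>u. u \<in> X) xp"
    and l: "l \<ge> 0" "l * L \<le> \<mu>"
    and lip: "norm (b - a) \<le> L * norm (y - w')"
  shows "xp \<in> X \<inter> interior dom"
    and "u \<in> X \<Longrightarrow> l * (b \<bullet> (y - u)) \<le> D u w - D u xp"
proof -
  have Xd: "X \<subseteq> dom"
    using sets by blast
  \<comment> \<open>The projection step is the proximal step with zero linear term.\<close>
  have w'': "is_arg_min (\<lambda>u. 0 * (0 \<bullet> u) + D u w) (\<lambda>u. u \<in> \<Omega>) w'"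
    using w' by simp
  note mw = bregman_prox_minimizer[OF w''] and my = bregman_prox_minimizer[OF y]
    and mx = bregman_prox_minimizer[OF xp]
  have xpi: "xp \<in> interior dom"
    using minimizer_interior[OF sets(1) Xd mx sets(5)] .
  then show "xp \<in> X \<inter> interior dom"
    using mx(1) by blast
  assume u: "u \<in> X"
  have 1: "l * (b \<bullet> xp) + D xp w + D u xp \<le> l * (b \<bullet> u) + D u w"
    using minimizer_three_point[OF sets(1) Xd mx u xpi]
    by (simp add: bregman_def inner_diff_left inner_diff_right)
  have 2: "l * (a \<bullet> y) + D y w + \<mu> / 2 * (norm (xp - y))\<^sup>2 \<le> l * (a \<bullet> xp) + D xp w"
    using minimizer_strong[OF sets(1) Xd my mx(1)]
    by (simp add: bregman_def inner_diff_left inner_diff_right)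
  have "y \<in> \<Omega>"
    using my(1) sets(3) by blast
  have "D w' w + \<mu> / 2 * (norm (y - w'))\<^sup>2 \<le> D y w"
    using minimizer_strong[OF sets(2) sets(4) mw \<open>y \<in> \<Omega>\<close>]
    by (simp add: bregman_def inner_diff_left inner_diff_right)
  moreover have "D w' w \<ge> 0"
    using bregman_nonneg w mw(1) sets(4) by blast
  ultimately have 3: "\<mu> / 2 * (norm (y - w'))\<^sup>2 \<le> D y w"
    by linarith
  have "l * ((b - a) \<bullet> (y - xp)) \<le> l * (norm (b - a) * norm (y - xp))"
    using l(1) norm_cauchy_schwarz by (intro mult_left_mono)
  also have "\<dots> \<le> l * ((L * norm (y - w')) * norm (y - xp))"
    using l(1) lip by (intro mult_left_mono mult_right_mono) auto
  also have "\<dots> = (l * L) * (norm (y - w') * norm (y - xp))"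
    by simp
  also have "\<dots> \<le> \<mu> * (norm (y - w') * norm (y - xp))"
    using l(2) by (intro mult_right_mono) auto
  also have "\<dots> \<le> \<mu> * (((norm (y - w'))\<^sup>2 + (norm (y - xp))\<^sup>2) / 2)"
    using mu_pos sum_squares_bound[of "norm (y - w')" "norm (y - xp)"]
    by (intro mult_left_mono) auto
  finally have 4: "l * ((b - a) \<bullet> (y - xp))
      \<le> \<mu> / 2 * (norm (y - w'))\<^sup>2 + \<mu> / 2 * (norm (xp - y))\<^sup>2"
    by (simp add: algebra_simps add_divide_distrib norm_minus_commute)
  have "l * (b \<bullet> (y - u)) = l * ((b - a) \<bullet> (y - xp)) + l * (a \<bullet> y) - l * (a \<bullet> xp)
      + l * (b \<bullet> xp) - l * (b \<bullet> u)"
    by (simp add: algebra_simps)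
  then show "l * (b \<bullet> (y - u)) \<le> D u w - D u xp"
    using 1 2 3 4 by linarith
qed

end

section \<open>The energy inequality of the algorithm\<close>

locale inertial_regularized_extragradient = legendre_strongly_convex \<omega> \<mu>
  for \<omega> :: "'a::euclidean_space \<Rightarrow> ereal" and \<mu> :: real +
  fixes F H :: "'a \<Rightarrow> 'a" and dom_F dom_H X \<Omega> :: "'a set"
    and L_F L_H lam_lo lam_hi :: real
    and \<alpha> lam \<eta> :: "nat \<Rightarrow> real" and w w' y x :: "nat \<Rightarrow> 'a"
  assumes F: "monotone_operator_on dom_F F" "L_F-lipschitz_on dom_F F"
    and H: "monotone_operator_on dom_H H" "L_H-lipschitz_on dom_H H"
    and L_F_pos: "L_F > 0"
    and X: "convex X" "bounded X" "X \<subseteq> \<Omega>"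
    and \<Omega>: "convex \<Omega>" "\<Omega> \<subseteq> dom" and dom_operators: "dom \<subseteq> dom_F \<inter> dom_H"
    and bdd_H: "bdd_above ((\<lambda>z. norm (H z)) ` X)"
    and bdd_bregman: "bdd_above (bregman_values \<omega> X)"
    and \<alpha>_nonneg: "\<And>k. \<alpha> k \<ge> 0" and \<eta>_pos: "\<And>k. \<eta> k > 0"
    and algorithm: "IneIREG_Bregman \<omega> F H X \<Omega> \<alpha> lam \<eta> w w' y x"
    and \<eta>_antimono: "\<And>k. \<eta> (Suc k) \<le> \<eta> k"
    and \<alpha>_0: "\<alpha> 0 \<le> 1" and ratio_antimono: "\<And>k. \<alpha> (Suc k) / \<eta> (Suc k) \<le> \<alpha> k / \<eta> k"
    and lam_bounds: "\<And>k. lam_lo \<le> lam k" "\<And>k. lam k \<le> lam_hi"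
    and lam_lo_pos: "0 < lam_lo" and lam_hi_le: "lam_hi \<le> \<mu> / (L_F + \<eta> 0 * L_H)"
begin

abbreviation Q where "Q \<equiv> VI_solutions F X"
abbreviation \<Omega>2 where "\<Omega>2 \<equiv> Sup (bregman_values \<omega> X)"
abbreviation C_H where "C_H \<equiv> SUP z\<in>X. norm (H z)"
abbreviation B_H where "B_H \<equiv> SUP z\<in>Q. norm (H z)"
abbreviation y_bar where "y_bar k \<equiv> (1 / (\<Sum>j<k. lam j)) *\<^sub>R (\<Sum>j<k. lam j *\<^sub>R y j)"

definition \<delta> :: "nat \<Rightarrow> real" where
  "\<delta> k = \<alpha> k * (1 + \<alpha> k) / (2 * \<mu>) * (norm (grad \<omega> (x k) - grad \<omega> (x (k - 1))))\<^sup>2"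

definition feasibility_bound :: "nat \<Rightarrow> real" where
  "feasibility_bound k = \<Omega>2 + (\<Sum>j<k. \<delta> j) + lam_hi * C_H * diameter X * (\<Sum>j<k. \<eta> j)"

definition optimality_bound :: "nat \<Rightarrow> real" where
  "optimality_bound k = \<Omega>2 / \<eta> k + (\<Sum>j<k. \<delta> j / \<eta> j)"

lemma X_subset: "X \<subseteq> dom" "X \<subseteq> dom_F" "X \<subseteq> dom_H"
  using X(3) \<Omega>(2) dom_operators by blast+

lemma lam_pos: "lam k > 0"
  using lam_lo_pos lam_bounds(1)[of k] by linarith

lemma \<delta>_nonneg: "\<delta> k \<ge> 0"
  using mu_pos \<alpha>_nonneg[of k] by (simp add: \<delta>_def)

lemma \<alpha>_antimono: "\<alpha> (Suc k) \<le> \<alpha> k"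
proof -
  have "\<alpha> (Suc k) = \<alpha> (Suc k) / \<eta> (Suc k) * \<eta> (Suc k)"
    using \<eta>_pos[of "Suc k"] by simp
  also have "\<dots> \<le> \<alpha> k / \<eta> k * \<eta> k"
    using ratio_antimono \<eta>_antimono \<alpha>_nonneg \<eta>_pos
    by (intro mult_mono) (auto intro: divide_nonneg_pos less_imp_le)
  also have "\<dots> = \<alpha> k"
    using \<eta>_pos[of k] by simp
  finally show ?thesis .
qed

lemma y_in_X: "y k \<in> X"
  using algorithm unfolding IneIREG_Bregman_def is_arg_min_def by blast

lemma w_interior: "w k \<in> interior dom"
  and grad_w: "grad \<omega> (w k) = (1 + \<alpha> k) *\<^sub>R grad \<omega> (x k) - \<alpha> k *\<^sub>R grad \<omega> (x (k - 1))"
  using algorithm mirror_step unfolding IneIREG_Bregman_def by metis+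

lemma regularized_operator_lipschitz:
  assumes "a \<in> dom" "b \<in> dom"
  shows "norm ((F a + \<eta> k *\<^sub>R H a) - (F b + \<eta> k *\<^sub>R H b)) \<le> (L_F + \<eta> 0 * L_H) * norm (a - b)"
proof -
  have dFH: "a \<in> dom_F" "b \<in> dom_F" "a \<in> dom_H" "b \<in> dom_H"
    using assms dom_operators by blast+
  have "\<eta> k \<le> \<eta> 0"
    using lift_Suc_antimono_le[of \<eta> 0 k] \<eta>_antimono by simp
  have "norm ((F a + \<eta> k *\<^sub>R H a) - (F b + \<eta> k *\<^sub>R H b))
      = norm ((F a - F b) + \<eta> k *\<^sub>R (H a - H b))"
    by (simp add: algebra_simps)
  also have "\<dots> \<le> norm (F a - F b) + \<eta> k * norm (H a - H b)"
    using norm_triangle_ineq[of "F a - F b" "\<eta> k *\<^sub>R (H a - H b)"] \<eta>_pos[of k] by simp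
  also have "\<dots> \<le> L_F * norm (a - b) + \<eta> 0 * (L_H * norm (a - b))"
    using lipschitz_onD[OF F(2) dFH(1,2)] lipschitz_onD[OF H(2) dFH(3,4)] \<eta>_pos \<open>\<eta> k \<le> \<eta> 0\<close>
    by (intro add_mono mult_mono) (auto simp: dist_norm less_imp_le)
  finally show ?thesis
    by (simp add: algebra_simps)
qed

lemma iterate_step:
  assumes "x k \<in> X \<inter> interior dom"
  shows "x (Suc k) \<in> X \<inter> interior dom"
    and "u \<in> X \<Longrightarrow> lam k * ((F (y k) + \<eta> k *\<^sub>R H (y k)) \<bullet> (y k - u)) \<le> D u (w k) - D u (x (Suc k))"
proof -
  have w': "is_arg_min (\<lambda>u. D u (w k)) (\<lambda>u. u \<in> \<Omega>) (w' k)"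
    and y: "is_arg_min (\<lambda>u. lam k * ((F (w' k) + \<eta> k *\<^sub>R H (w' k)) \<bullet> u) + D u (w k)) (\<lambda>u. u \<in> X) (y k)"
    and xp: "is_arg_min (\<lambda>u. lam k * ((F (y k) + \<eta> k *\<^sub>R H (y k)) \<bullet> u) + D u (w k)) (\<lambda>u. u \<in> X) (x (Suc k))"
    using algorithm unfolding IneIREG_Bregman_def by blast+
  have ne: "X \<inter> interior dom \<noteq> {}"
    using assms by blast
  have "L_H \<ge> 0"
    using H(2) lipschitz_on_nonneg by blast
  then have L: "L_F + \<eta> 0 * L_H > 0"
    using L_F_pos \<eta>_pos[of 0] by (simp add: add_pos_nonneg)
  have "lam k \<le> \<mu> / (L_F + \<eta> 0 * L_H)"
    using lam_bounds(2)[of k] lam_hi_le by linarith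
  then have l: "lam k * (L_F + \<eta> 0 * L_H) \<le> \<mu>"
    using L by (simp add: pos_le_divide_eq)
  have "w' k \<in> \<Omega>"
    using w' unfolding is_arg_min_def by blast
  then have "norm ((F (y k) + \<eta> k *\<^sub>R H (y k)) - (F (w' k) + \<eta> k *\<^sub>R H (w' k)))
      \<le> (L_F + \<eta> 0 * L_H) * norm (y k - w' k)"
    using y_in_X[of k] X_subset(1) \<Omega>(2) by (intro regularized_operator_lipschitz) auto
  note * = extragradient_step[OF w_interior X(1) \<Omega>(1) X(3) \<Omega>(2) ne w' y xp
      less_imp_le[OF lam_pos] l this]
  show "x (Suc k) \<in> X \<inter> interior dom"
    by (rule *(1))
  show "u \<in> X \<Longrightarrow> lam k * ((F (y k) + \<eta> k *\<^sub>R H (y k)) \<bullet> (y k - u)) \<le> D u (w k) - D u (x (Suc k))"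
    by (rule *(2))
qed

text \<open>Interiority propagates because the feasible set of the next proximal step contains the current
  iterate, an interior point.\<close>

lemma x_in_X_interior: "x k \<in> X \<inter> interior dom"
proof (induction k)
  case 0
  then show ?case
    using algorithm by (simp add: IneIREG_Bregman_def)
qed (rule iterate_step(1))

text \<open>Monotonicity moves the operators from \<open>y k\<close> to \<open>u\<close>; the extragradient step bounds the result by
  \<open>D u (w k) - D u (x (Suc k))\<close>, and the inertial estimate replaces \<open>w k\<close> by
  \<open>x k\<close> and \<open>x (k - 1)\<close>.\<close>

lemma energy_inequality:
  assumes u: "u \<in> X"
  shows "lam k * (F u \<bullet> (y k - u)) + lam k * \<eta> k * (H u \<bullet> (y k - u))
    \<le> (D u (x k) - D u (x (Suc k))) + \<alpha> k * (D u (x k) - D u (x (k - 1))) + \<delta> k"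
proof -
  have "F u \<bullet> (y k - u) \<le> F (y k) \<bullet> (y k - u)" "H u \<bullet> (y k - u) \<le> H (y k) \<bullet> (y k - u)"
    using F(1) H(1) u y_in_X[of k] X_subset unfolding monotone_operator_on_def
    by (force simp: inner_diff_left)+
  then have "lam k * (F u \<bullet> (y k - u)) + lam k * \<eta> k * (H u \<bullet> (y k - u))
      \<le> lam k * (F (y k) \<bullet> (y k - u)) + lam k * \<eta> k * (H (y k) \<bullet> (y k - u))"
    using lam_pos[of k] \<eta>_pos[of k] by (intro add_mono mult_left_mono) auto
  also have "\<dots> = lam k * ((F (y k) + \<eta> k *\<^sub>R H (y k)) \<bullet> (y k - u))"
    by (simp add: inner_add_left distrib_left)
  also have "\<dots> \<le> D u (w k) - D u (x (Suc k))"
    by (rule iterate_step(2)[OF x_in_X_interior u])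
  also have "D u (w k) \<le> D u (x k) + \<alpha> k * (D u (x k) - D u (x (k - 1))) + \<delta> k"
    unfolding \<delta>_def using u X_subset(1) x_in_X_interior
    by (intro inertial_bregman_le w_interior grad_w \<alpha>_nonneg) auto
  finally show ?thesis by simp
qed

lemma bregman_iterate_bounds:
  assumes "u \<in> X"
  shows "0 \<le> D u (x k)" and "D u (x k) \<le> \<Omega>2"
proof -
  show "0 \<le> D u (x k)"
    using assms X_subset(1) x_in_X_interior[of k] by (intro bregman_nonneg) auto
  have "D u (x k) \<in> bregman_values \<omega> X"
    using assms x_in_X_interior[of k] unfolding bregman_values_def by blast
  then show "D u (x k) \<le> \<Omega>2"
    using bdd_bregman by (rule cSup_upper)
qed

lemma \<Omega>2_nonneg: "0 \<le> \<Omega>2"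
  using bregman_iterate_bounds[of "x 0" 0] x_in_X_interior[of 0] by force

lemma norm_H_le_C_H: "z \<in> X \<Longrightarrow> norm (H z) \<le> C_H"
  using bdd_H by (rule cSUP_upper2) auto

lemma C_H_nonneg: "0 \<le> C_H"
  using norm_H_le_C_H[OF y_in_X[of 0]] norm_ge_zero order_trans by blast

section \<open>Summation and ergodic averages\<close>

text \<open>Summation by parts with the constant weight 1: \<open>\<alpha>\<close> is nonincreasing as the
  product of the nonincreasing \<open>\<alpha> / \<eta>\<close> and \<open>\<eta>\<close>, and the regularisation term is treated as a perturbation of size \<open>C_H * diameter X\<close>.\<close>

lemma feasibility_sum:
  assumes u: "u \<in> X" and k: "k \<ge> 1"
  shows "(\<Sum>j<k. lam j * (F u \<bullet> (y j - u))) \<le> feasibility_bound k"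
proof -
  obtain n where n: "k = Suc n"
    using k by (cases k) auto
  have "lam j * (F u \<bullet> (y j - u)) \<le> (1 * (D u (x j) - D u (x (Suc j)))
      + \<alpha> j * (D u (x j) - D u (x (j - 1)))) + (\<delta> j + lam_hi * C_H * diameter X * \<eta> j)" for j
  proof -
    have "- (H u \<bullet> (y j - u)) \<le> norm (H u) * norm (y j - u)"
      using Cauchy_Schwarz_ineq2[of "H u" "y j - u"] by linarith
    also have "\<dots> \<le> C_H * diameter X"
      using norm_H_le_C_H[OF u] C_H_nonneg diameter_bounded_bound[OF X(2) y_in_X u]
      by (intro mult_mono) (auto simp: dist_norm)
    finally have "lam j * \<eta> j * - (H u \<bullet> (y j - u)) \<le> lam j * \<eta> j * (C_H * diameter X)"
      using lam_pos \<eta>_pos by (intro mult_left_mono) (auto simp: less_imp_le)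
    also have "\<dots> \<le> lam_hi * \<eta> j * (C_H * diameter X)"
      using lam_bounds \<eta>_pos C_H_nonneg diameter_ge_0[OF X(2)]
      by (intro mult_right_mono) (auto simp: less_imp_le)
    finally show ?thesis
      using energy_inequality[OF u, of j] by (simp add: mult_ac)
  qed
  then have "(\<Sum>j<k. lam j * (F u \<bullet> (y j - u)))
      \<le> (\<Sum>j<k. (1 * (D u (x j) - D u (x (Suc j))) + \<alpha> j * (D u (x j) - D u (x (j - 1))))
          + (\<delta> j + lam_hi * C_H * diameter X * \<eta> j))"
    by (intro sum_mono)
  also have "\<dots> = (\<Sum>j<k. 1 * (D u (x j) - D u (x (Suc j))) + \<alpha> j * (D u (x j) - D u (x (j - 1))))
      + ((\<Sum>j<k. \<delta> j) + lam_hi * C_H * diameter X * (\<Sum>j<k. \<eta> j))"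
    by (simp add: sum.distrib sum_distrib_left)
  also have "(\<Sum>j<k. 1 * (D u (x j) - D u (x (Suc j))) + \<alpha> j * (D u (x j) - D u (x (j - 1))))
      \<le> 1 * \<Omega>2"
    unfolding n using bregman_iterate_bounds[OF u] \<alpha>_nonneg \<alpha>_antimono \<alpha>_0
    by (intro inertial_summation_by_parts) auto
  finally show ?thesis
    by (simp add: feasibility_bound_def)
qed

text \<open>Dividing the energy inequality by \<open>\<eta> j\<close> isolates \<open>H\<close>, and the \<open>F\<close> term is nonnegative at a
  solution. The telescoping weights become \<open>1 / \<eta> j\<close>, nondecreasing, and the inertial ones
  \<open>\<alpha> j / \<eta> j\<close>, nonincreasing.\<close>

lemma optimality_sum:
  assumes u: "u \<in> Q" and k: "k \<ge> 1"
  shows "(\<Sum>j<k. lam j * (H u \<bullet> (y j - u))) \<le> optimality_bound k"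
proof -
  have uX: "u \<in> X"
    using u by (simp add: VI_solutions_def)
  obtain n where n: "k = Suc n"
    using k by (cases k) auto
  have "lam j * (H u \<bullet> (y j - u)) \<le> (1 / \<eta> j * (D u (x j) - D u (x (Suc j)))
      + \<alpha> j / \<eta> j * (D u (x j) - D u (x (j - 1)))) + \<delta> j / \<eta> j" for j
  proof -
    have "0 \<le> lam j * (F u \<bullet> (y j - u))"
      using u y_in_X lam_pos[of j] by (simp add: VI_solutions_def)
    then have "\<eta> j * (lam j * (H u \<bullet> (y j - u)))
        \<le> (D u (x j) - D u (x (Suc j))) + \<alpha> j * (D u (x j) - D u (x (j - 1))) + \<delta> j"
      using energy_inequality[OF uX, of j] by (simp add: mult_ac)
    then have "lam j * (H u \<bullet> (y j - u))
        \<le> ((D u (x j) - D u (x (Suc j))) + \<alpha> j * (D u (x j) - D u (x (j - 1))) + \<delta> j) / \<eta> j"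
      using \<eta>_pos[of j] by (simp add: pos_le_divide_eq mult.commute)
    then show ?thesis
      by (simp add: add_divide_distrib)
  qed
  then have "(\<Sum>j<k. lam j * (H u \<bullet> (y j - u)))
      \<le> (\<Sum>j<k. (1 / \<eta> j * (D u (x j) - D u (x (Suc j)))
          + \<alpha> j / \<eta> j * (D u (x j) - D u (x (j - 1)))) + \<delta> j / \<eta> j)"
    by (intro sum_mono)
  also have "\<dots> = (\<Sum>j<k. 1 / \<eta> j * (D u (x j) - D u (x (Suc j)))
          + \<alpha> j / \<eta> j * (D u (x j) - D u (x (j - 1)))) + (\<Sum>j<k. \<delta> j / \<eta> j)"
    by (rule sum.distrib)
  also have "(\<Sum>j<k. 1 / \<eta> j * (D u (x j) - D u (x (Suc j)))
          + \<alpha> j / \<eta> j * (D u (x j) - D u (x (j - 1)))) \<le> 1 / \<eta> n * \<Omega>2"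
    unfolding n
  proof (rule inertial_summation_by_parts)
    show "0 \<le> D u (x j)" "D u (x j) \<le> \<Omega>2" for j
      using bregman_iterate_bounds[OF uX] by auto
    show "0 \<le> \<alpha> j / \<eta> j" for j
      using \<alpha>_nonneg[of j] \<eta>_pos[of j] by simp
    show "1 / \<eta> j \<le> 1 / \<eta> (Suc j)" for j
      using \<eta>_antimono[of j] \<eta>_pos[of "Suc j"] by (simp add: frac_le)
    show "\<alpha> 0 / \<eta> 0 \<le> 1 / \<eta> 0"
      using \<alpha>_0 \<eta>_pos[of 0] by (simp add: divide_right_mono)
  qed (rule ratio_antimono)
  also have "1 / \<eta> n * \<Omega>2 \<le> \<Omega>2 / \<eta> k"
    using \<eta>_antimono[of n] \<eta>_pos[of "Suc n"] \<Omega>2_nonneg by (simp add: n frac_le)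
  finally show ?thesis
    by (simp add: optimality_bound_def)
qed

text \<open>Nonnegativity of \<open>R\<close> allows the total weight to be replaced by its lower bound
  \<open>real k * lam_lo\<close>.\<close>

lemma ergodic_average_le:
  assumes k: "k \<ge> 1" and le: "(\<Sum>j<k. lam j * (a \<bullet> (y j - u))) \<le> R" and R: "0 \<le> R"
  shows "a \<bullet> (y_bar k - u) \<le> 1 / (real k * lam_lo) * R"
proof -
  let ?\<Lambda> = "\<Sum>j<k. lam j"
  have "real k * lam_lo = (\<Sum>j<k. lam_lo)"
    by simp
  also have "\<dots> \<le> ?\<Lambda>"
    using lam_bounds by (intro sum_mono)
  finally have \<Lambda>: "real k * lam_lo \<le> ?\<Lambda>" .
  have pos: "0 < real k * lam_lo"
    using k lam_lo_pos by simp
  with \<Lambda> have \<Lambda>_pos: "?\<Lambda> > 0"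
    by linarith
  have "(\<Sum>j<k. lam j * (a \<bullet> (y j - u))) = ?\<Lambda> * (a \<bullet> (y_bar k - u))"
  proof -
    have "(\<Sum>j<k. lam j * (a \<bullet> (y j - u))) = a \<bullet> (\<Sum>j<k. lam j *\<^sub>R y j) - ?\<Lambda> * (a \<bullet> u)"
      by (simp add: inner_diff_right inner_sum_right right_diff_distrib sum_subtractf sum_distrib_right)
    also have "a \<bullet> (\<Sum>j<k. lam j *\<^sub>R y j) = ?\<Lambda> * (a \<bullet> y_bar k)"
      using \<Lambda>_pos by simp
    finally show ?thesis
      by (simp add: inner_diff_right right_diff_distrib)
  qed
  then have "?\<Lambda> * (a \<bullet> (y_bar k - u)) \<le> R"
    using le by simp
  then have "a \<bullet> (y_bar k - u) \<le> R / ?\<Lambda>"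
    using \<Lambda>_pos by (simp add: pos_le_divide_eq mult.commute)
  also have "\<dots> \<le> R / (real k * lam_lo)"
    using \<Lambda> pos R by (intro divide_left_mono) (auto intro: mult_pos_pos \<Lambda>_pos)
  finally show ?thesis by simp
qed

lemma y_bar_in_X:
  assumes "k \<ge> 1"
  shows "y_bar k \<in> X"
proof -
  let ?\<Lambda> = "\<Sum>j<k. lam j"
  have "?\<Lambda> > 0"
    using assms lam_pos by (intro sum_pos) (auto simp: lessThan_empty_iff)
  then have "(\<Sum>j<k. (lam j / ?\<Lambda>) *\<^sub>R y j) \<in> X"
    using X(1) y_in_X lam_pos
    by (intro convex_sum) (auto simp: sum_divide_distrib[symmetric] less_imp_le)
  then show ?thesis
    by (simp add: scaleR_sum_right)
qed

lemma feasibility_bound_nonneg: "0 \<le> feasibility_bound k"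
  using \<Omega>2_nonneg \<delta>_nonneg \<eta>_pos C_H_nonneg diameter_ge_0[OF X(2)] lam_lo_pos lam_bounds[of 0]
  unfolding feasibility_bound_def
  by (intro add_nonneg_nonneg mult_nonneg_nonneg sum_nonneg) (auto simp: less_imp_le)

lemma optimality_bound_nonneg: "0 \<le> optimality_bound k"
  using \<Omega>2_nonneg \<delta>_nonneg \<eta>_pos unfolding optimality_bound_def
  by (intro add_nonneg_nonneg divide_nonneg_pos sum_nonneg) auto

lemma F_gap_value_le:
  assumes "k \<ge> 1" "u \<in> X"
  shows "F u \<bullet> (y_bar k - u) \<le> 1 / (real k * lam_lo) * feasibility_bound k"
  using ergodic_average_le feasibility_sum feasibility_bound_nonneg assms by blast

lemma H_gap_value_le:
  assumes "k \<ge> 1" "u \<in> Q"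
  shows "H u \<bullet> (y_bar k - u) \<le> 1 / (real k * lam_lo) * optimality_bound k"
  using ergodic_average_le optimality_sum optimality_bound_nonneg assms by blast

section \<open>Bounds on the dual gaps\<close>

text \<open>The lower bound is the value of the gap at \<open>u = y_bar k\<close>, a point of \<open>X\<close>. The pointwise upper
  bound shows that this value enters a supremum of a bounded set.\<close>

lemma feasibility:
  assumes k: "k \<ge> 1"
  shows "0 \<le> dual_gap (y_bar k) F X"
    and "dual_gap (y_bar k) F X \<le> 1 / (real k * lam_lo) * feasibility_bound k"
proof -
  have "bdd_above ((\<lambda>u. F u \<bullet> (y_bar k - u)) ` X)"
    using F_gap_value_le[OF k] by (rule bdd_aboveI2)
  then show "0 \<le> dual_gap (y_bar k) F X"
    unfolding dual_gap_def by (rule cSUP_upper2[OF _ y_bar_in_X[OF k]]) simp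
  show "dual_gap (y_bar k) F X \<le> 1 / (real k * lam_lo) * feasibility_bound k"
    unfolding dual_gap_def using y_in_X F_gap_value_le[OF k] by (intro cSUP_least) auto
qed

context
  assumes Q_nonempty: "Q \<noteq> {}"
begin

lemma norm_H_le_B_H: "z \<in> Q \<Longrightarrow> norm (H z) \<le> B_H"
  using bdd_H by (intro cSUP_upper2[of _ _ z])
    (auto simp: VI_solutions_def intro: bdd_above_mono)

lemma B_H_nonneg: "0 \<le> B_H"
  using Q_nonempty norm_H_le_B_H norm_ge_zero order_trans by blast

text \<open>For the lower bound, Cauchy--Schwarz gives the bound \<open>- B_H * dist (y_bar k) q\<close> for each \<open>q\<close> in the
  solution set. Passing to the infimum over \<open>q\<close> divides by \<open>B_H\<close>, so the case \<open>B_H = 0\<close> is separate.\<close>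

lemma optimality:
  assumes k: "k \<ge> 1"
  shows "- B_H * infdist (y_bar k) Q \<le> dual_gap (y_bar k) H Q"
    and "dual_gap (y_bar k) H Q \<le> 1 / (real k * lam_lo) * optimality_bound k"
proof -
  show "dual_gap (y_bar k) H Q \<le> 1 / (real k * lam_lo) * optimality_bound k"
    unfolding dual_gap_def using Q_nonempty H_gap_value_le[OF k] by (intro cSUP_least) auto
  have bdd: "bdd_above ((\<lambda>u. H u \<bullet> (y_bar k - u)) ` Q)"
    using H_gap_value_le[OF k] by (rule bdd_aboveI2)
  have near: "- B_H * dist (y_bar k) q \<le> dual_gap (y_bar k) H Q" if q: "q \<in> Q" for q
  proof -
    have "- (H q \<bullet> (y_bar k - q)) \<le> norm (H q) * norm (y_bar k - q)"
      using Cauchy_Schwarz_ineq2[of "H q" "y_bar k - q"] by linarith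
    also have "\<dots> \<le> B_H * dist (y_bar k) q"
      unfolding dist_norm using norm_H_le_B_H[OF q] by (rule mult_right_mono) simp
    finally have "- B_H * dist (y_bar k) q \<le> H q \<bullet> (y_bar k - q)"
      by simp
    then show ?thesis
      unfolding dual_gap_def by (rule cSUP_upper2[OF bdd q])
  qed
  show "- B_H * infdist (y_bar k) Q \<le> dual_gap (y_bar k) H Q"
  proof (cases "B_H = 0")
    case True
    then show ?thesis
      using near Q_nonempty by fastforce
  next
    case False
    then have B: "B_H > 0"
      using B_H_nonneg by linarith
    have "- dual_gap (y_bar k) H Q / B_H \<le> infdist (y_bar k) Q"
      unfolding infdist_notempty[OF Q_nonempty]
    proof (rule cINF_greatest[OF Q_nonempty])
      fix q assume "q \<in> Q"
      then have "- dual_gap (y_bar k) H Q \<le> dist (y_bar k) q * B_H"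
        using near by (fastforce simp: mult.commute)
      then show "- dual_gap (y_bar k) H Q / B_H \<le> dist (y_bar k) q"
        by (rule pos_divide_le_eq[OF B, THEN iffD2])
    qed
    then have "- dual_gap (y_bar k) H Q \<le> infdist (y_bar k) Q * B_H"
      by (rule pos_divide_le_eq[OF B, THEN iffD1])
    then show ?thesis
      by (simp only: mult_minus_left mult.commute minus_le_iff)
  qed
qed

text \<open>Weak sharpness at any solution, combined with the feasibility estimate there, bounds the distance
  of the average to the solution set; this distance enters the lower bound of \<open>optimality\<close>.\<close>

lemma optimality_weakly_sharp:
  assumes sharp: "weakly_sharp \<sigma> M F X Q" and k: "k \<ge> 1"
  shows "- (B_H / \<sigma> powr (1 / M)) * (1 / (real k * lam_lo) * feasibility_bound k) powr (1 / M)
    \<le> dual_gap (y_bar k) H Q"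
proof -
  define R where "R = 1 / (real k * lam_lo) * feasibility_bound k"
  have \<sigma>: "\<sigma> > 0" and M: "M \<ge> 1"
    using sharp by (auto simp: weakly_sharp_def)
  have R: "0 \<le> R"
    unfolding R_def using feasibility_bound_nonneg[of k] lam_lo_pos by simp
  obtain q where q: "q \<in> Q"
    using Q_nonempty by blast
  then have "\<sigma> * infdist (y_bar k) Q powr M \<le> F q \<bullet> (y_bar k - q)"
    using sharp y_bar_in_X[OF k] unfolding weakly_sharp_def by blast
  also have "\<dots> \<le> R"
    unfolding R_def using F_gap_value_le[OF k] q by (simp add: VI_solutions_def)
  finally have "infdist (y_bar k) Q powr M * \<sigma> \<le> R"
    by (simp only: mult.commute)
  then have "infdist (y_bar k) Q powr M \<le> R / \<sigma>"
    by (rule pos_le_divide_eq[OF \<sigma>, THEN iffD2])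
  then have "(infdist (y_bar k) Q powr M) powr (1 / M) \<le> (R / \<sigma>) powr (1 / M)"
    using M by (intro powr_mono2) auto
  then have "infdist (y_bar k) Q \<le> R powr (1 / M) / \<sigma> powr (1 / M)"
    using M R \<sigma> infdist_nonneg[of "y_bar k" Q] by (simp add: powr_powr powr_divide)
  then have "B_H * infdist (y_bar k) Q \<le> B_H * (R powr (1 / M) / \<sigma> powr (1 / M))"
    using B_H_nonneg by (rule mult_left_mono)
  then show ?thesis
    using optimality(1)[OF k] unfolding R_def by simp
qed

end

end

section \<open>Convergence rates\<close>

theorem theorem8:
  fixes \<omega> :: "real ^ 'n \<Rightarrow> ereal"
    and F H :: "real ^ 'n \<Rightarrow> real ^ 'n"
    and dom_F dom_H X \<Omega> Q :: "(real ^ 'n) set"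
    and \<mu> L_F L_H L_0 C_H B_H D_X \<Omega>2_X lam_lo lam_hi :: real
    and \<alpha> lam \<eta> \<delta> \<Lambda> :: "nat \<Rightarrow> real"
    and w w' y x y_bar :: "nat \<Rightarrow> real ^ 'n"
  defines "Q \<equiv> VI_solutions F X"
    and "C_H \<equiv> (SUP z\<in>X. norm (H z))"
    and "B_H \<equiv> (SUP z\<in>Q. norm (H z))"
    and "D_X \<equiv> diameter X"
    and "\<Omega>2_X \<equiv> Sup (bregman_values \<omega> X)"
    and "L_0 \<equiv> L_F + \<eta> 0 * L_H"
    and "\<delta> \<equiv> \<lambda>k. \<alpha> k * (1 + \<alpha> k) / (2 * \<mu>) * (norm (grad \<omega> (x k) - grad \<omega> (x (k - 1))))\<^sup>2"
    and "\<Lambda> \<equiv> \<lambda>k. \<Sum>j<k. lam j"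
    and "y_bar \<equiv> \<lambda>k. (1 / \<Lambda> k) *\<^sub>R (\<Sum>j<k. lam j *\<^sub>R y j)"
  assumes "strongly_convex_fun \<mu> \<omega>" and "legendre \<omega>"
    and "monotone_operator_on dom_F F" and "L_F > 0" and "L_F-lipschitz_on dom_F F"
    and "monotone_operator_on dom_H H" and "L_H > 0" and "L_H-lipschitz_on dom_H H"
    and "X \<noteq> {}" and "closed X" and "convex X"
    and "\<Omega> \<noteq> {}" and "closed \<Omega>" and "convex \<Omega>"
    and "X \<subseteq> \<Omega>" and "\<Omega> \<subseteq> eff_dom \<omega>" and "eff_dom \<omega> \<subseteq> dom_F \<inter> dom_H"
    and "Q \<noteq> {}"
    and "bdd_above ((\<lambda>z. norm (H z)) ` X)" and "bdd_above ((\<lambda>z. norm (H z)) ` Q)"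
    and "bounded X" and "bdd_above (bregman_values \<omega> X)"
    and "\<And>k. \<alpha> k \<ge> 0" and "\<And>k. lam k > 0" and "\<And>k. \<eta> k > 0"
    and "IneIREG_Bregman \<omega> F H X \<Omega> \<alpha> lam \<eta> w w' y x"
    and "\<And>k. \<eta> k \<ge> \<eta> (Suc k)"
    and "\<alpha> 0 \<in> {0..1}" and "\<And>k. \<alpha> k / \<eta> k \<ge> \<alpha> (Suc k) / \<eta> (Suc k)"
    and "\<And>k. lam k \<in> {lam_lo..lam_hi}"
    and "0 < lam_lo" and "lam_lo \<le> lam_hi" and "lam_hi \<le> \<mu> / L_0"
    and "summable (\<lambda>k. \<delta> k / \<eta> k)"
  shows "(\<forall>k\<ge>1.
            0 \<le> dual_gap (y_bar k) F X \<and>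
            dual_gap (y_bar k) F X
              \<le> 1 / (real k * lam_lo) * (\<Omega>2_X + (\<Sum>j<k. \<delta> j) + lam_hi * C_H * D_X * (\<Sum>j<k. \<eta> j)))
       \<and> (\<forall>k\<ge>1.
            - B_H * infdist (y_bar k) Q \<le> dual_gap (y_bar k) H Q \<and>
            dual_gap (y_bar k) H Q
              \<le> 1 / (real k * lam_lo) * (\<Omega>2_X / \<eta> k + (\<Sum>j<k. \<delta> j / \<eta> j)))
       \<and> (\<forall>\<sigma> M. weakly_sharp \<sigma> M F X Q \<longrightarrow> (\<forall>k\<ge>1.
            - (B_H / \<sigma> powr (1 / M)) *
              (1 / (real k * lam_lo) *
                (\<Omega>2_X + (\<Sum>j<k. \<delta> j) + lam_hi * C_H * D_X * (\<Sum>j<k. \<eta> j))) powr (1 / M)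
            \<le> dual_gap (y_bar k) H Q))"
proof -
  interpret alg: inertial_regularized_extragradient \<omega> \<mu> F H dom_F dom_H X \<Omega> L_F L_H
    lam_lo lam_hi \<alpha> lam \<eta> w w' y x
    using assms by unfold_locales (auto simp: L_0_def)
  have ne: "VI_solutions F X \<noteq> {}"
    using \<open>Q \<noteq> {}\<close> unfolding Q_def .
  have \<delta>: "\<delta> = alg.\<delta>"
    by (auto simp: \<delta>_def alg.\<delta>_def)
  show ?thesis
    unfolding Q_def C_H_def B_H_def D_X_def \<Omega>2_X_def y_bar_def \<Lambda>_def \<delta>
    using alg.feasibility alg.optimality[OF ne] alg.optimality_weakly_sharp[OF ne]
    unfolding alg.feasibility_bound_def alg.optimality_bound_def
    by blast
qed

end
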